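(* Let $\lambda$ be a nonzero real number and $m$ a positive integer. For every integer $n\ge 0$, $$d_{m,\lambda}(n,x)=\sum_{k=0}^{n}\Big\{\sum_{j=k}^{n}S_{1,\lambda}(j,k)\,W_{m,\lambda}(n,j)\Big\}\phi_{k,\lambda}(x).$$
   Context: For $\lambda\neq 0$: $(x)_{0,\lambda}=1$ and $(x)_{n,\lambda}=x(x-\lambda)\cdots(x-(n-1)\lambda)$ for $n\ge1$. The degenerate exponential is $e_\lambda^{x}(t)=\sum_{k\ge0}(x)_{k,\lambda}\frac{t^k}{k!}=(1+\lambda t)^{x/\lambda}$, $e_\lambda(t)=e_\lambda^1(t)$, and $\log_\lambda(1+t)=\frac{1}{\lambda}\big((1+t)^\lambda-1\big)$. The degenerate Stirling numbers of the first kind are defined by $\frac{1}{k!}(\log_\lambda(1+t))^k=\sum_{n\ge k}S_{1,\lambda}(n,k)\frac{t^n}{n!}$. The degenerate Whitney numbers of the second kind are defined by $e_\lambda(t)\frac{1}{k!}\Big(\frac{e_\lambda^{m}(t)-1}{m}\Big)^k=\sum_{n\ge k}W_{m,\lambda}(n,k)\frac{t^n}{n!}$, and the fully degenerate Dowling polynomials are $d_{m,\lambda}(n,x)=\sum_{k=0}^{n}W_{m,\lambda}(n,k)(x)_{k,\lambda}$. The fully degenerate Bell polynomials $\phi_{n,\lambda}(x)$ are defined by $e_\lambda^{x}\big(e_\lambda(t)-1\big)=\sum_{n\ge0}\phi_{n,\lambda}(x)\frac{t^n}{n!}$. *)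

theory Defs
  imports Complex_Main "HOL-Computational_Algebra.Formal_Power_Series"
begin

text \<open>All generating functions are formal power series in \<open>t = fps_X\<close> over the reals.\<close>

definition deg_falling :: "real \<Rightarrow> real \<Rightarrow> nat \<Rightarrow> real" where
  "deg_falling lam x n = (\<Prod>i<n. x - real i * lam)"

definition deg_exp :: "real \<Rightarrow> real \<Rightarrow> real fps" where
  "deg_exp lam x = Abs_fps (\<lambda>k. deg_falling lam x k / fact k)"

text \<open>The closed form \<open>(1 + \<lambda>t) powr (x / \<lambda>)\<close>, read formally.\<close>

lemma deg_exp_eq_binomial:
  assumes "lam \<noteq> 0"
  shows "deg_exp lam x = fps_binomial (x / lam) oo (fps_const lam * fps_X)"
proof -
  have "x - real i * lam = lam * (x / lam - real i)" for i
    using assms by (simp add: field_simps)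
  then have "deg_falling lam x k = lam ^ k * (\<Prod>i<k. x / lam - real i)" for k
    unfolding deg_falling_def by (simp add: prod.distrib)
  then show ?thesis
    by (simp add: fps_eq_iff deg_exp_def fps_compose_linear gbinomial_prod_rev atLeast0LessThan)
qed

text \<open>\<open>log\<^sub>\<lambda>(1 + t) = ((1 + t) powr \<lambda> - 1) / \<lambda>\<close>, where \<open>fps_binomial \<lambda>\<close> is the
  series of \<open>(1 + t) powr \<lambda>\<close>.\<close>

definition deg_log :: "real \<Rightarrow> real fps" where
  "deg_log lam = fps_const (1 / lam) * (fps_binomial lam - 1)"

text \<open>Each of the following numbers is \<open>fact n\<close> times the coefficient of \<open>t ^ n\<close> in its
  exponential generating function.\<close>

definition deg_S1 :: "real \<Rightarrow> nat \<Rightarrow> nat \<Rightarrow> real" where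
  "deg_S1 lam n k = fact n * fps_nth (fps_const (1 / fact k) * deg_log lam ^ k) n"

definition deg_Whitney :: "nat \<Rightarrow> real \<Rightarrow> nat \<Rightarrow> nat \<Rightarrow> real" where
  "deg_Whitney m lam n k =
     fact n * fps_nth (deg_exp lam 1 * fps_const (1 / fact k) *
       (fps_const (1 / real m) * (deg_exp lam (real m) - 1)) ^ k) n"

definition deg_Dowling :: "nat \<Rightarrow> real \<Rightarrow> nat \<Rightarrow> real \<Rightarrow> real" where
  "deg_Dowling m lam n x = (\<Sum>k=0..n. deg_Whitney m lam n k * deg_falling lam x k)"

definition deg_Bell :: "nat \<Rightarrow> real \<Rightarrow> real \<Rightarrow> real" where
  "deg_Bell n lam x = fact n * fps_nth (deg_exp lam x oo (deg_exp lam 1 - 1)) n"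

text \<open>The defining generating functions start at \<open>t ^ k\<close>, so nothing is lost by
  reading the numbers off coefficientwise.\<close>

lemma deg_S1_eq_0:
  assumes "n < k"
  shows "deg_S1 lam n k = 0"
proof -
  have "fps_nth (deg_log lam) 0 = 0"
    by (simp add: deg_log_def)
  then show ?thesis
    using assms startsby_zero_power_prefix[of "deg_log lam" k] by (simp add: deg_S1_def)
qed

lemma deg_Whitney_eq_0:
  assumes "n < k"
  shows "deg_Whitney m lam n k = 0"
proof -
  let ?a = "fps_const (1 / real m) * (deg_exp lam (real m) - 1)"
  have "fps_nth ?a 0 = 0"
    by (simp add: deg_exp_def deg_falling_def)
  then have "fps_nth (?a ^ k) i = 0" if "i \<le> n" for i
    using assms that startsby_zero_power_prefix[of ?a k] by simp
  then show ?thesis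
    by (simp add: deg_Whitney_def fps_mult_nth)
qed

end

theory Submission
  imports Defs
begin

text \<open>
  The series \<open>deg_exp lam 1 - 1\<close> and \<open>deg_log lam\<close> are compositional inverses of each other.
  Substituting \<open>deg_log lam\<close> for \<open>t\<close> in the generating function of the Bell polynomials hence
  gives back \<open>deg_exp lam x\<close>, so that comparing coefficients expresses the degenerate falling
  factorials through the Bell polynomials with Stirling coefficients. Inserting this expansion
  into the definition of the Dowling polynomials and exchanging the sums yields the claim.
\<close>

text \<open>Both sides have constant term 1 and solve the equation
  \<open>(1 + t) f' = a b f\<close>, whose solutions are determined by their constant term.\<close>

lemma fps_binomial_compose_fps_binomial:
  fixes a b :: "'a :: field_char_0"
  shows "fps_binomial a oo (fps_binomial b - 1) = fps_binomial (a * b)"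
proof -
  define g where "g = fps_binomial b - 1"
  define f where "f = fps_binomial a oo g"
  have g0: "fps_nth g 0 = 0"
    by (simp add: g_def)
  have X0: "fps_nth (1 + fps_X :: 'a fps) 0 \<noteq> 0"
    by simp
  have deriv: "fps_deriv (fps_binomial c) * (1 + fps_X) = fps_const c * fps_binomial c"
    for c :: 'a
    using fps_binomial_ODE_unique[of "fps_binomial c" c] X0
    by (simp add: fps_divide_unit inverse_mult_eq_1 mult.assoc)
  have "(fps_deriv (fps_binomial a) * (1 + fps_X)) oo g = (fps_const a * fps_binomial a) oo g"
    by (simp only: deriv)
  \<comment> \<open>Since \<open>1 + g = fps_binomial b\<close>, substituting \<open>g\<close> turns
    the factor \<open>1 + fps_X\<close> into \<open>fps_binomial b\<close>.\<close>
  then have outer: "(fps_deriv (fps_binomial a) oo g) * fps_binomial b = fps_const a * f"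
    using g0 by (simp add: fps_compose_mult_distrib fps_compose_add_distrib f_def) (simp add: g_def)
  have inner: "fps_deriv g * (1 + fps_X) = fps_const b * fps_binomial b"
    using deriv[of b] by (simp add: g_def)
  have "fps_deriv f * (1 + fps_X) * fps_binomial b
      = ((fps_deriv (fps_binomial a) oo g) * fps_binomial b) * (fps_deriv g * (1 + fps_X))"
    using g0 by (simp add: f_def fps_compose_deriv mult_ac)
  also have "\<dots> = (fps_const (a * b) * f) * fps_binomial b"
    unfolding outer inner by (simp add: mult_ac flip: fps_const_mult)
  \<comment> \<open>The common factor \<open>fps_binomial b\<close> has constant term 1, so it is
    nonzero and cancels.\<close>
  finally have "fps_deriv f * (1 + fps_X) = fps_const (a * b) * f"
    by (metis fps_binomial_nth gbinomial_0(1) fps_zero_nth mult_cancel_right zero_neq_one)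
  then have "fps_deriv f = fps_const (a * b) * f / (1 + fps_X)"
    using X0 by (metis fps_zero_nth nonzero_mult_div_cancel_right)
  then have "f = fps_const (fps_nth f 0) * fps_binomial (a * b)"
    by (simp add: fps_binomial_ODE_unique)
  then show ?thesis
    by (simp add: f_def g_def)
qed

lemma deg_log_nth_0 [simp]: "fps_nth (deg_log lam) 0 = 0"
  by (simp add: deg_log_def)

lemma deg_exp_nth_0 [simp]: "fps_nth (deg_exp lam x) 0 = 1"
  by (simp add: deg_exp_def deg_falling_def)

text \<open>As \<open>deg_exp lam x\<close> is \<open>(1 + lam t)^(x / lam)\<close> and
  \<open>1 + lam * deg_log lam\<close> is \<open>(1 + t)^lam\<close>, the exponents multiply to
  \<open>x\<close>.\<close>

lemma deg_exp_compose_deg_log: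
  assumes "lam \<noteq> 0"
  shows "deg_exp lam x oo deg_log lam = fps_binomial x"
proof -
  have "deg_exp lam x oo deg_log lam
      = fps_binomial (x / lam) oo ((fps_const lam * fps_X) oo deg_log lam)"
    by (simp add: deg_exp_eq_binomial[OF assms] fps_compose_assoc)
  also have "(fps_const lam * fps_X) oo deg_log lam = fps_binomial lam - 1"
    using assms by (simp add: fps_compose_mult_distrib) (simp add: deg_log_def flip: mult.assoc)
  finally show ?thesis
    using assms by (simp add: fps_binomial_compose_fps_binomial)
qed

lemma deg_falling_eq_sum_deg_Bell:
  assumes "lam \<noteq> 0"
  shows "deg_falling lam x j = (\<Sum>k=0..j. deg_S1 lam j k * deg_Bell k lam x)"
proof -
  let ?B = "deg_exp lam x oo (deg_exp lam 1 - 1)"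
  have "(deg_exp lam 1 - 1) oo deg_log lam = fps_X"
    by (simp add: fps_compose_sub_distrib deg_exp_compose_deg_log[OF assms] fps_binomial_1)
  then have "?B oo deg_log lam = deg_exp lam x"
    by (simp flip: fps_compose_assoc)
  then have "deg_falling lam x j = fact j * fps_nth (?B oo deg_log lam) j"
    by (simp add: deg_exp_def)
  \<comment> \<open>In each term the \<open>fact k\<close> from \<open>deg_Bell\<close> cancels the
    \<open>1 / fact k\<close> from \<open>deg_S1\<close>.\<close>
  also have "\<dots> = (\<Sum>k=0..j. deg_S1 lam j k * deg_Bell k lam x)"
    unfolding fps_compose_nth[of ?B] sum_distrib_left
    by (simp add: deg_S1_def deg_Bell_def mult_ac)
  finally show ?thesis .
qed

theorem theorem12:
  fixes lam x :: real and m n :: nat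
  assumes "lam \<noteq> 0" and "m > 0"
  shows "deg_Dowling m lam n x =
    (\<Sum>k=0..n. (\<Sum>j=k..n. deg_S1 lam j k * deg_Whitney m lam n j) * deg_Bell k lam x)"
proof -
  have "deg_Dowling m lam n x
      = (\<Sum>j=0..n. \<Sum>k=0..j. deg_S1 lam j k * deg_Whitney m lam n j * deg_Bell k lam x)"
    by (simp add: deg_Dowling_def deg_falling_eq_sum_deg_Bell[OF assms(1)] sum_distrib_left mult_ac)
  \<comment> \<open>Both double sums run over the pairs with
    \<open>k \<le> j \<le> n\<close>.\<close>
  also have "\<dots> = (\<Sum>k=0..n. \<Sum>j=k..n. deg_S1 lam j k * deg_Whitney m lam n j * deg_Bell k lam x)"
    unfolding sum.Sigma[OF finite_atLeastAtMost ballI[OF finite_atLeastAtMost]]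
    by (rule sum.reindex_bij_witness[of _ prod.swap prod.swap]) auto
  finally show ?thesis
    by (simp add: sum_distrib_right)
qed

end
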